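(* Given $\ell\in\mathbb{R}^+$, consider the unit square grid and a uniformly random segment of length $\ell$. Let $t=\tau(\ell)$ be the maximum number of tiles that a segment of length $\ell$ can visit. The probability $\rho(\ell)$ that the random segment visits the maximum number of tiles $t$ is $$\rho(\ell) = \sum_{\substack{i,j\geq 2,\ i+j-1=t,\\ (i-2)^2+(j-2)^2<\ell^2}} g(\ell,i-2,j-2),$$ where the sum is over integers $i,j$; or equivalently, defining $w=\sqrt{\ell^2-(t-3)^2/2}$, $$\rho(\ell) = g\left(\ell,\tfrac{t-3}{2},\tfrac{t-3}{2}\right) + 2\sum_{k=1}^{\left\lceil \frac{w}{\sqrt2}-1\right\rceil} g\left(\ell,\tfrac{t-3}{2}-k,\tfrac{t-3}{2}+k\right)\quad\text{for } t \text{ odd},$$ $$\rho(\ell) = 2\,g\left(\ell,\tfrac{t-4}{2},\tfrac{t-2}{2}\right) + 2\sum_{k=1}^{\left\lceil \frac{w}{\sqrt2}-\frac32\right\rceil} g\left(\ell,\tfrac{t-4}{2}-k,\tfrac{t-2}{2}+k\right)\quad\text{for } t \text{ even}.$$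
   Context: $\mathbb{R}^+=(0,\infty)$. The unit square grid consists of the lines $x=k$ and $y=k$, $k\in\mathbb{Z}$, in $\mathbb{R}^2$; its tiles are the squares $[k,k+1]\times[m,m+1]$, $k,m\in\mathbb{Z}$. A line segment visits a tile if it intersects the interior of the tile. For $\ell\in\mathbb{R}^+$, $\tau(\ell)$ is the maximum number of tiles visited by a line segment of length $\ell$, over all positions and orientations in the plane. A uniformly random segment of length $\ell$ is the segment with endpoints $(x_1,y_1)$ and $(x_1+\ell\cos\theta,\,y_1+\ell\sin\theta)$, where $x_1,y_1,\theta$ are independent random variables uniformly distributed on $[0,1)$, $[0,1)$ and $[0,2\pi)$ respectively. For non-negative integers $u,v$ and $s\in\mathbb{R}^+$ (used here only with $u^2+v^2<s^2$), $$g(s,u,v) = \frac{2}{\pi}\int_{\arcsin\frac{v}{s}}^{\arccos\frac{u}{s}} (s\cos\theta-u)(s\sin\theta-v)\,\mathrm{d}\theta ,$$ with $\arcsin$ and $\arccos$ the principal branches. A sum whose upper limit is smaller than its lower limit is empty (equal to $0$). *)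

theory Defs
  imports "HOL-Probability.Probability"
begin

definition tile :: "int \<Rightarrow> int \<Rightarrow> (real \<times> real) set" where
  "tile k m = {real_of_int k .. real_of_int k + 1} \<times> {real_of_int m .. real_of_int m + 1}"

definition tiles :: "(real \<times> real) set set" where
  "tiles = {tile k m | k m. True}"

definition visits :: "(real \<times> real) set \<Rightarrow> (real \<times> real) set \<Rightarrow> bool" where
  "visits S T \<longleftrightarrow> S \<inter> interior T \<noteq> {}"

definition num_visited :: "(real \<times> real) set \<Rightarrow> nat" where
  "num_visited S = card {T \<in> tiles. visits S T}"

definition tau :: "real \<Rightarrow> nat" where
  "tau l = Max {num_visited (closed_segment p q) | p q. dist p q = l}"

definition segment_at :: "real \<Rightarrow> real \<Rightarrow> real \<Rightarrow> real \<Rightarrow> (real \<times> real) set" where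
  "segment_at l x y \<theta> = closed_segment (x, y) (x + l * cos \<theta>, y + l * sin \<theta>)"

text \<open>
  The arguments \<open>u\<close>, \<open>v\<close> are meant to be non-negative integers with \<open>u\<^sup>2 + v\<^sup>2 < s\<^sup>2\<close>, so that
  the lower limit of integration is smaller than the upper one. They are typed as reals so that
  half-integer expressions such as \<open>(t - 3) / 2\<close>, integral for \<open>t\<close> of the right parity, can be
  written without truncating division.
\<close>

definition gfun :: "real \<Rightarrow> real \<Rightarrow> real \<Rightarrow> real" where
  "gfun s u v =
     2 / pi * integral {arcsin (v / s) .. arccos (u / s)}
                (\<lambda>\<theta>. (s * cos \<theta> - u) * (s * sin \<theta> - v))"

end

theory Submission
  imports Defs
begin

text \<open>
  Along a segment with direction \<open>(a, b)\<close>, \<open>a, b \<ge> 0\<close>, the visited tiles form a chain for the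
  product order, so the map \<open>(k, m) \<mapsto> k + m\<close> is injective on them. A segment meeting \<open>i\<close> columns
  and \<open>j\<close> rows therefore visits at most \<open>i + j - 1\<close> tiles, with equality if it avoids the lattice
  points, which happens almost surely. Meeting \<open>i \<ge> 2\<close> columns forces \<open>\<bar>a\<bar> > i - 2\<close>, so \<open>\<tau>(l)\<close> is the
  maximum of \<open>u + v + 3\<close> over naturals with \<open>u\<^sup>2 + v\<^sup>2 < l\<^sup>2\<close>.

  Fix \<open>\<theta>\<close> and put \<open>(a, b) = (l cos \<theta>, l sin \<theta>)\<close>. If \<open>i + j - 1 = \<tau>(l)\<close>, maximality excludes
  \<open>\<bar>a\<bar> > i - 1\<close> together with \<open>\<bar>b\<bar> > j - 2\<close>, and symmetrically. Hence the probability over the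
  starting point of meeting exactly \<open>i\<close> columns and \<open>j\<close> rows is the product of the positive parts of
  \<open>\<bar>a\<bar> - (i - 2)\<close> and \<open>\<bar>b\<bar> - (j - 2)\<close>, and integrating over \<open>\<theta>\<close> gives \<open>g(l, i - 2, j - 2)\<close> by
  symmetry between the four quadrants.
\<close>

subsection \<open>Tiles visited by a segment\<close>

text \<open>Tiles are recorded by their lower left corner and the segment by its start and
  displacement, so that the symmetries of the grid act on the arguments by sign changes and
  exchanges.\<close>

definition visited :: "real \<Rightarrow> real \<Rightarrow> real \<Rightarrow> real \<Rightarrow> (int \<times> int) set" where
  "visited x y a b = {(k, m). \<exists>s\<in>{0..1}.
     of_int k < x + s * a \<and> x + s * a < of_int k + 1 \<and>
     of_int m < y + s * b \<and> y + s * b < of_int m + 1}"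

lemma visitedI:
  assumes "0 \<le> s" "s \<le> 1" "of_int k < x + s * a" "x + s * a < of_int k + 1"
    "of_int m < y + s * b" "y + s * b < of_int m + 1"
  shows "(k, m) \<in> visited x y a b"
  using assms by (auto simp: visited_def)

lemma interior_tile:
  "interior (tile k m) = {of_int k<..<of_int k + 1} \<times> {of_int m<..<of_int m + 1}"
  by (simp add: tile_def interior_Times)

lemma inj_tile: "inj (\<lambda>(k, m). tile k m)"
proof (rule injI, clarify)
  fix k m k' m' assume "tile k m = tile k' m'"
  then have "interior (tile k m) = interior (tile k' m')" by simp
  moreover have "(of_int k + 1/2, of_int m + 1/2) \<in> interior (tile k m)"
    by (simp add: interior_tile)
  ultimately have "(of_int k + 1/2, of_int m + 1/2 :: real) \<in> interior (tile k' m')" by simp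
  then show "k = k' \<and> m = m'" by (auto simp: interior_tile)
qed

lemma num_visited_eq_card:
  "num_visited (closed_segment (x, y) (x + a, y + b)) = card (visited x y a b)"
proof -
  have pt: "(1 - s) *\<^sub>R (x, y) + s *\<^sub>R (x + a, y + b) = (x + s * a, y + s * b)" for s :: real
    by (simp add: algebra_simps)
  have "visits (closed_segment (x, y) (x + a, y + b)) (tile k m) \<longleftrightarrow> (k, m) \<in> visited x y a b" for k m
    unfolding visits_def closed_segment_def interior_tile pt visited_def
    by (auto simp: disjoint_iff mem_Times_iff; blast)
  then have "{T \<in> tiles. visits (closed_segment (x, y) (x + a, y + b)) T}
      = (\<lambda>(k, m). tile k m) ` visited x y a b"
    unfolding tiles_def by auto
  then show ?thesis
    unfolding num_visited_def by (simp add: card_image inj_on_subset[OF inj_tile])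
qed

text \<open>The mirror image of the column from \<open>k\<close> to \<open>k + 1\<close> is the one
  that starts at \<open>- k - 1\<close>.\<close>

lemma card_visited_reflect_x: "card (visited (- x) y (- a) b) = card (visited x y a b)"
proof (rule bij_betw_same_card[of "\<lambda>(k, m). (- k - 1, m)"])
  have "(k, m) \<in> visited (- x) y (- a) b \<longleftrightarrow> (- k - 1, m) \<in> visited x y a b" for k m
    unfolding visited_def by (auto; rule_tac x=s in bexI; auto)
  then show "bij_betw (\<lambda>(k, m). (- k - 1, m)) (visited (- x) y (- a) b) (visited x y a b)"
    by (intro bij_betwI[where g = "\<lambda>(k, m). (- k - 1, m)"]) auto
qed

lemma card_visited_swap: "card (visited y x b a) = card (visited x y a b)"
  by (rule bij_betw_same_card[of prod.swap], rule bij_betwI[where g = prod.swap])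
     (auto simp: visited_def)

lemma card_visited_reflect_y: "card (visited x (- y) a (- b)) = card (visited x y a b)"
  by (metis card_visited_swap card_visited_reflect_x)

lemma card_visited_first_quadrant:
  "\<exists>x' y'. card (visited x y a b) = card (visited x' y' \<bar>a\<bar> \<bar>b\<bar>)"
  by (metis abs_if card_visited_reflect_x card_visited_reflect_y)

lemma finite_visited: "finite (visited x y a b)"
proof (rule finite_subset)
  define A B where "A = \<bar>x\<bar> + \<bar>a\<bar> + 1" and "B = \<bar>y\<bar> + \<bar>b\<bar> + 1"
  have ab: "\<bar>s * c\<bar> \<le> \<bar>c\<bar>" if "0 \<le> s" "s \<le> 1" for s c :: real
    using that mult_left_le_one_le[of "\<bar>c\<bar>" s] by (simp add: abs_mult)
  show "visited x y a b \<subseteq> {\<lfloor>- A\<rfloor>..\<lceil>A\<rceil>} \<times> {\<lfloor>- B\<rfloor>..\<lceil>B\<rceil>}"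
  proof (clarsimp simp: visited_def)
    fix k m s assume s: "0 \<le> s" "s \<le> 1" and
      h: "of_int k < x + s * a" "x + s * a < of_int k + 1"
         "of_int m < y + s * b" "y + s * b < of_int m + 1"
    have "\<bar>of_int k\<bar> \<le> A" "\<bar>of_int m\<bar> \<le> B"
      using h ab[OF s, of a] ab[OF s, of b] unfolding A_def B_def by linarith+
    then show "\<lfloor>- A\<rfloor> \<le> k \<and> k \<le> \<lceil>A\<rceil> \<and> \<lfloor>- B\<rfloor> \<le> m \<and> m \<le> \<lceil>B\<rceil>"
      by linarith
  qed
qed auto

text \<open>Both coordinates are nondecreasing along the segment, so the tile met at the smaller
  parameter cannot lie to the right of or above the other.\<close>

lemma visited_chain:
  assumes "0 \<le> a" "0 \<le> b" "(k, m) \<in> visited x y a b" "(k', m') \<in> visited x y a b"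
  shows "k \<le> k' \<and> m \<le> m' \<or> k' \<le> k \<and> m' \<le> m"
proof -
  have *: "k \<le> k'" if "of_int k < x + s * a" "x + s' * a < of_int k' + 1" "s \<le> s'" "0 \<le> a"
    for k k' :: int and x s s' a :: real
    using that mult_right_mono[of s s' a] by linarith
  from assms(3,4) obtain s s' where s:
    "of_int k < x + s * a" "x + s * a < of_int k + 1"
    "of_int m < y + s * b" "y + s * b < of_int m + 1"
    "of_int k' < x + s' * a" "x + s' * a < of_int k' + 1"
    "of_int m' < y + s' * b" "y + s' * b < of_int m' + 1"
    unfolding visited_def by auto
  show ?thesis
    using s assms(1,2) by (cases "s \<le> s'") (auto intro: *)
qed

text \<open>Every column strictly between the two tiles is traversed in full and uses up one unit of
  the displacement. Truncation by \<open>nat\<close> covers equal, adjacent and reversed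
  columns.\<close>

lemma visited_gap_x:
  assumes "0 \<le> a" "(k, m) \<in> visited x y a b" "(k', m') \<in> visited x y a b"
  shows "nat (k' - k - 1) = 0 \<or> real (nat (k' - k - 1)) < a"
proof -
  from assms(2,3) obtain s s' where s: "0 \<le> s" "s' \<le> 1"
    "x + s * a < of_int k + 1" "of_int k' < x + s' * a"
    unfolding visited_def by auto
  then have "of_int (k' - k - 1) < (s' - s) * a" by (simp add: algebra_simps)
  also have "\<dots> \<le> 1 * a" using s assms(1) by (intro mult_right_mono) auto
  finally show ?thesis by auto
qed

lemma visited_gap_y:
  assumes "0 \<le> b" "(k, m) \<in> visited x y a b" "(k', m') \<in> visited x y a b"
  shows "nat (m' - m - 1) = 0 \<or> real (nat (m' - m - 1)) < b"
  by (rule visited_gap_x[of b m k y x a m' k']) (use assms in \<open>auto simp: visited_def\<close>)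

lemma inj_on_visited:
  assumes "0 \<le> a" "0 \<le> b"
  shows "inj_on (\<lambda>(k, m). k + m) (visited x y a b)"
  using visited_chain[OF assms] by (intro inj_onI) fastforce

text \<open>By \<open>inj_on_visited\<close> the tiles are counted by their values
  \<open>k + m\<close>, which lie between two extreme ones. The witnesses \<open>u\<close> and
  \<open>v\<close> are the numbers of columns and rows strictly between the two extreme
  tiles.\<close>

lemma card_visited_le:
  assumes "a\<^sup>2 + b\<^sup>2 > 0"
  shows "\<exists>u v :: nat. (real u)\<^sup>2 + (real v)\<^sup>2 < a\<^sup>2 + b\<^sup>2 \<and> card (visited x y a b) \<le> u + v + 3"
proof -
  have main: "\<exists>u v :: nat. (real u)\<^sup>2 + (real v)\<^sup>2 < a\<^sup>2 + b\<^sup>2 \<and> card (visited x y a b) \<le> u + v + 3"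
    if a: "0 \<le> a" "0 \<le> b" and pos: "a\<^sup>2 + b\<^sup>2 > 0" for x y a b :: real
  proof (cases "visited x y a b = {}")
    case True
    then show ?thesis using pos by (intro exI[of _ 0]) auto
  next
    case False
    let ?V = "visited x y a b" and ?f = "\<lambda>(k, m). k + m :: int"
    have fin: "finite (?f ` ?V)" and ne: "?f ` ?V \<noteq> {}" using finite_visited False by auto
    obtain k0 m0 where 0: "(k0, m0) \<in> ?V" "k0 + m0 = Min (?f ` ?V)"
      using Min_in[OF fin ne] by force
    obtain k1 m1 where 1: "(k1, m1) \<in> ?V" "k1 + m1 = Max (?f ` ?V)"
      using Max_in[OF fin ne] by force
    have "card ?V = card (?f ` ?V)" by (simp add: card_image inj_on_visited a)
    also have "\<dots> \<le> card {k0 + m0..k1 + m1}"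
      by (intro card_mono) (auto simp: 0 1 fin intro!: Min_le Max_ge rev_image_eqI)
    finally have c: "card ?V \<le> nat (k1 + m1 - (k0 + m0) + 1)" by (simp add: algebra_simps)
    have le: "k0 \<le> k1" "m0 \<le> m1"
    proof -
      have "k0 + m0 \<le> k1 + m1" using 0 1 fin by (metis Max_ge Min_in ne)
      then show "k0 \<le> k1" "m0 \<le> m1" using visited_chain[OF a 0(1) 1(1)] by auto
    qed
    define u v where "u = nat (k1 - k0 - 1)" and "v = nat (m1 - m0 - 1)"
    have u: "u = 0 \<or> real u < a" and v: "v = 0 \<or> real v < b"
      using visited_gap_x[OF a(1) 0(1) 1(1)] visited_gap_y[OF a(2) 0(1) 1(1)] by (auto simp: u_def v_def)
    have "(real u)\<^sup>2 + (real v)\<^sup>2 < a\<^sup>2 + b\<^sup>2"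
    proof -
      have u2: "u = 0 \<or> (real u)\<^sup>2 < a\<^sup>2" and v2: "v = 0 \<or> (real v)\<^sup>2 < b\<^sup>2"
        using u v by (auto intro: power_strict_mono)
      show ?thesis
        using u2 v2 pos zero_le_power2[of a] zero_le_power2[of b]
        by (elim disjE; simp only: power_zero_numeral of_nat_0; linarith)
    qed
    moreover have "card ?V \<le> u + v + 3" using c le unfolding u_def v_def by linarith
    ultimately show ?thesis by blast
  qed
  obtain x' y' where "card (visited x y a b) = card (visited x' y' \<bar>a\<bar> \<bar>b\<bar>)"
    using card_visited_first_quadrant by blast
  then show ?thesis using main[of "\<bar>a\<bar>" "\<bar>b\<bar>" x' y'] assms by simp
qed

section \<open>Exact tile count in general position\<close>

text \<open>The last clause says that the supporting line contains no lattice point; hence a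
  vertical and a horizontal grid line are never crossed at the same time.\<close>

definition generic :: "real \<Rightarrow> real \<Rightarrow> real \<Rightarrow> real \<Rightarrow> bool" where
  "generic x y a b \<longleftrightarrow> a \<noteq> 0 \<and> b \<noteq> 0 \<and> (\<forall>k::int. x \<noteq> of_int k \<and> x + a \<noteq> of_int k \<and>
     y \<noteq> of_int k \<and> y + b \<noteq> of_int k) \<and> (\<forall>k m :: int. (x - of_int k) * b \<noteq> (y - of_int m) * a)"

lemma generic_swap: "generic x y a b \<Longrightarrow> generic y x b a"
  unfolding generic_def by metis

lemma generic_reflect_x:
  assumes "generic x y a b"
  shows "generic (- x) y (- a) b"
proof -
  have "- x \<noteq> of_int k \<and> - x + - a \<noteq> of_int k" for k
    using assms[unfolded generic_def, THEN conjunct2, THEN conjunct2, THEN conjunct1, rule_format, of "- k"]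
    by auto
  moreover have "(- x - of_int k) * b \<noteq> (y - of_int m) * - a" for k m
    using assms[unfolded generic_def, THEN conjunct2, THEN conjunct2, THEN conjunct2, rule_format, of "- k" m]
    by (auto simp: algebra_simps)
  ultimately show ?thesis using assms unfolding generic_def by auto
qed

lemma generic_reflect_y: "generic x y a b \<Longrightarrow> generic x (- y) a (- b)"
  by (metis generic_swap generic_reflect_x)

text \<open>The two quotients are the parameters at which the line reaches the right side of the
  column and the top of the row. If the right side comes first, the segment goes on into the right
  neighbour.\<close>

lemma visited_next_right:
  assumes "0 < a" "0 < b" "(k, m) \<in> visited x y a b"
    and "(of_int k + 1 - x) / a < 1" "(of_int k + 1 - x) / a < (of_int m + 1 - y) / b"
  shows "(k + 1, m) \<in> visited x y a b"
proof -
  let ?s1 = "(of_int k + 1 - x) / a"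
  obtain s where s: "0 \<le> s" "x + s * a < of_int k + 1" "of_int m < y + s * b"
    using assms(3) unfolding visited_def by auto
  \<comment> \<open>This leaves room for a parameter just after the crossing but before the end, the
    top of the row and the far side of the next column.\<close>
  have "?s1 < Min {1, (of_int m + 1 - y) / b, (of_int k + 2 - x) / a}"
    using assms by (auto simp: divide_strict_right_mono)
  then obtain s' where s': "?s1 < s'" "s' < Min {1, (of_int m + 1 - y) / b, (of_int k + 2 - x) / a}"
    using dense by blast
  have "s < ?s1" using s assms by (simp add: field_simps)
  then have "s < s'" using s' by linarith
  then have y: "of_int m < y + s' * b" using s(3) assms(2) mult_strict_right_mono[of s s' b] by linarith
  show ?thesis
    using s s' assms \<open>s < s'\<close> by (intro visitedI[of s'] y) (auto simp: field_simps)
qed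

lemma visited_next:
  assumes g: "generic x y a b" and ab: "0 < a" "0 < b" and V: "(k, m) \<in> visited x y a b"
    and lt: "k + m < \<lfloor>x + a\<rfloor> + \<lfloor>y + b\<rfloor>"
  shows "\<exists>k' m'. (k', m') \<in> visited x y a b \<and> k' + m' = k + m + 1"
proof -
  let ?s1 = "(of_int k + 1 - x) / a" and ?s2 = "(of_int m + 1 - y) / b"
  \<comment> \<open>If both sides were reached only at parameter 1 or later, the floors of the
    endpoint would be at most \<open>k\<close> and \<open>m\<close>, against
    \<open>lt\<close>.\<close>
  have lt1: "?s1 < 1 \<or> ?s2 < 1"
  proof (rule ccontr)
    assume "\<not> ?thesis"
    then have "x + a \<le> of_int (k + 1)" "y + b \<le> of_int (m + 1)" using ab by (auto simp: field_simps)
    moreover have "x + a \<noteq> of_int (k + 1)" "y + b \<noteq> of_int (m + 1)"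
      using g unfolding generic_def by blast+
    ultimately have "x + a < of_int (k + 1)" "y + b < of_int (m + 1)" by auto
    then have "\<lfloor>x + a\<rfloor> < k + 1" "\<lfloor>y + b\<rfloor> < m + 1" by (simp_all only: floor_less_iff)
    then show False using lt by linarith
  qed
  \<comment> \<open>Equal parameters would put the lattice point \<open>(k + 1, m + 1)\<close> on
    the line.\<close>
  have ne: "?s1 \<noteq> ?s2"
  proof
    assume "?s1 = ?s2"
    then have "(x - of_int (k + 1)) * b = (y - of_int (m + 1)) * a"
      using ab by (simp add: field_simps)
    then show False using g unfolding generic_def by blast
  qed
  show ?thesis
  proof (cases "?s1 < ?s2")
    case True
    then have "?s1 < 1" using lt1 by linarith
    then have "(k + 1, m) \<in> visited x y a b" using True ab V by (intro visited_next_right)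
    then show ?thesis by (intro exI[of _ "k + 1"] exI[of _ m]) auto
  next
    case False
    then have "?s2 < 1" "?s2 < ?s1" using ne lt1 by linarith+
    then have "(m + 1, k) \<in> visited y x b a"
      using ab V by (intro visited_next_right) (auto simp: visited_def)
    then show ?thesis by (intro exI[of _ "k"] exI[of _ "m + 1"]) (auto simp: visited_def)
  qed
qed

text \<open>From the tile of the initial point, \<open>visited_next\<close> raises
  \<open>k + m\<close> in steps of one up to the tile of the endpoint. The values of
  \<open>k + m\<close> thus fill an integer interval, and \<open>inj_on_visited\<close> counts the
  tiles.\<close>

lemma card_visited_generic_pos:
  assumes g: "generic x y a b" and ab: "0 < a" "0 < b"
  shows "int (card (visited x y a b)) = (\<lfloor>x + a\<rfloor> - \<lfloor>x\<rfloor>) + (\<lfloor>y + b\<rfloor> - \<lfloor>y\<rfloor>) + 1"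
proof -
  let ?f = "\<lambda>(k, m). k + m :: int" and ?V = "visited x y a b"
  have fl: "of_int \<lfloor>z\<rfloor> < z" if "\<forall>k::int. z \<noteq> of_int k" for z :: real
    using that[rule_format, of "\<lfloor>z\<rfloor>"] of_int_floor_le[of z] by linarith
  have start: "(\<lfloor>x\<rfloor>, \<lfloor>y\<rfloor>) \<in> ?V"
    using g by (intro visitedI[of 0]) (auto simp: generic_def intro!: fl)
  have "?f ` ?V = {\<lfloor>x\<rfloor> + \<lfloor>y\<rfloor>..\<lfloor>x + a\<rfloor> + \<lfloor>y + b\<rfloor>}"
  proof (intro antisym subsetI)
    fix N assume "N \<in> ?f ` ?V"
    then obtain k m s where s: "N = k + m" "0 \<le> s" "s \<le> 1" "of_int k < x + s * a" "x + s * a < of_int k + 1"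
      "of_int m < y + s * b" "y + s * b < of_int m + 1" by (auto simp: visited_def)
    have "0 \<le> s * a" "s * a \<le> a" "0 \<le> s * b" "s * b \<le> b"
      using ab s by (auto intro: mult_left_le_one_le)
    then have "\<lfloor>x\<rfloor> \<le> k" "\<lfloor>y\<rfloor> \<le> m" "k \<le> \<lfloor>x + a\<rfloor>" "m \<le> \<lfloor>y + b\<rfloor>"
      using s by linarith+
    then show "N \<in> {\<lfloor>x\<rfloor> + \<lfloor>y\<rfloor>..\<lfloor>x + a\<rfloor> + \<lfloor>y + b\<rfloor>}" using s(1) by auto
  next
    fix N assume N: "N \<in> {\<lfloor>x\<rfloor> + \<lfloor>y\<rfloor>..\<lfloor>x + a\<rfloor> + \<lfloor>y + b\<rfloor>}"
    then have "\<lfloor>x\<rfloor> + \<lfloor>y\<rfloor> \<le> N" by simp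
    then show "N \<in> ?f ` ?V" using N
    proof (induction N rule: int_ge_induct)
      case base
      then show ?case using start by force
    next
      case (step N)
      then obtain k m where "(k, m) \<in> ?V" "N = k + m" by auto
      moreover have "k + m < \<lfloor>x + a\<rfloor> + \<lfloor>y + b\<rfloor>" using step.prems calculation by auto
      ultimately show ?case using visited_next[OF g ab, of k m] by force
    qed
  qed
  then have "card ?V = card {\<lfloor>x\<rfloor> + \<lfloor>y\<rfloor>..\<lfloor>x + a\<rfloor> + \<lfloor>y + b\<rfloor>}"
    using card_image[OF inj_on_visited[of a b x y]] ab by simp
  moreover have "\<lfloor>x\<rfloor> \<le> \<lfloor>x + a\<rfloor>" "\<lfloor>y\<rfloor> \<le> \<lfloor>y + b\<rfloor>" using ab by (auto intro: floor_mono)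
  ultimately show ?thesis by simp
qed

lemma floor_minus_nonint:
  assumes "\<forall>k::int. z \<noteq> of_int k"
  shows "\<lfloor>- z :: real\<rfloor> = - \<lfloor>z\<rfloor> - 1"
proof -
  have "of_int \<lfloor>z\<rfloor> < z" "z < of_int \<lfloor>z\<rfloor> + 1"
    using assms[rule_format, of "\<lfloor>z\<rfloor>"] of_int_floor_le[of z] by linarith+
  then show ?thesis by linarith
qed

text \<open>Reflections reduce to positive displacements. They keep the absolute floor differences,
  because negating a non-integer sends its floor \<open>n\<close> to \<open>- n - 1\<close> and the
  shift cancels.\<close>

lemma card_visited_generic:
  assumes "generic x y a b"
  shows "int (card (visited x y a b)) = \<bar>\<lfloor>x + a\<rfloor> - \<lfloor>x\<rfloor>\<bar> + \<bar>\<lfloor>y + b\<rfloor> - \<lfloor>y\<rfloor>\<bar> + 1"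
proof -
  have pp: "int (card (visited x y a b)) = \<bar>\<lfloor>x + a\<rfloor> - \<lfloor>x\<rfloor>\<bar> + \<bar>\<lfloor>y + b\<rfloor> - \<lfloor>y\<rfloor>\<bar> + 1"
    if "generic x y a b" "0 < a" "0 < b" for x y a b
    using card_visited_generic_pos[OF that] that by (simp add: floor_mono)
  have fd: "\<bar>\<lfloor>- x + - a\<rfloor> - \<lfloor>- x\<rfloor>\<bar> = \<bar>\<lfloor>x + a\<rfloor> - \<lfloor>x\<rfloor>\<bar>"
    if "\<forall>k::int. x \<noteq> of_int k" "\<forall>k::int. x + a \<noteq> of_int k" for x a :: real
    using floor_minus_nonint[OF that(1)] floor_minus_nonint[OF that(2)] by simp
  have p: "int (card (visited x y a b)) = \<bar>\<lfloor>x + a\<rfloor> - \<lfloor>x\<rfloor>\<bar> + \<bar>\<lfloor>y + b\<rfloor> - \<lfloor>y\<rfloor>\<bar> + 1"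
    if g: "generic x y a b" and "0 < a" for x y a b
  proof (cases "b > 0")
    case False
    then have "- b > 0" using g unfolding generic_def by auto
    then show ?thesis
      using pp[OF generic_reflect_y[OF g] \<open>0 < a\<close>] fd[of y b] g
      by (simp add: card_visited_reflect_y generic_def)
  qed (use pp that in auto)
  show ?thesis
  proof (cases "a > 0")
    case False
    then have "- a > 0" using assms unfolding generic_def by auto
    then show ?thesis
      using p[OF generic_reflect_x[OF assms]] fd[of x a] assms
      by (simp add: card_visited_reflect_x generic_def)
  qed (use p assms in auto)
qed

lemma countable_bad_y: "countable {y :: real. \<exists>k::int. y = of_int k \<or> y + b = of_int k}"
proof (rule countable_subset)
  show "{y :: real. \<exists>k::int. y = of_int k \<or> y + b = of_int k}
     \<subseteq> range (of_int :: int \<Rightarrow> real) \<union> range (\<lambda>k::int. of_int k - b)"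
    by (force simp: image_iff algebra_simps)
qed auto

text \<open>With \<open>y\<close> fixed and \<open>b\<close> nonzero, each lattice point rules out a
  single \<open>x\<close>; the lattice clause of \<open>generic\<close> is thus charged to
  \<open>x\<close> alone.\<close>

lemma countable_bad_x:
  assumes "b \<noteq> 0"
  shows "countable {x :: real. (\<exists>k::int. x = of_int k \<or> x + a = of_int k) \<or>
    (\<exists>k m :: int. (x - of_int k) * b = (y - of_int m) * a)}"
proof (rule countable_subset)
  show "{x :: real. (\<exists>k::int. x = of_int k \<or> x + a = of_int k) \<or>
    (\<exists>k m :: int. (x - of_int k) * b = (y - of_int m) * a)}
     \<subseteq> {x. \<exists>k::int. x = of_int k \<or> x + a = of_int k} \<union>
       range (\<lambda>(k::int, m::int). of_int k + (y - of_int m) * a / b)"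
    using assms by (auto simp: image_iff field_simps)
qed (auto simp: countable_bad_y)

lemma ex_generic:
  assumes "a \<noteq> 0" "b \<noteq> 0" "c < 1" "d < 1"
  shows "\<exists>x y. c < x \<and> x < 1 \<and> d < y \<and> y < 1 \<and> generic x y a b"
proof -
  have *: "\<exists>x. c < x \<and> x < 1 \<and> x \<notin> A" if "countable A" "c < 1" for A and c :: real
  proof (rule ccontr)
    assume "\<not> ?thesis"
    then have "{c<..<1} \<subseteq> A" by auto
    then show False using countable_subset that uncountable_open_interval by metis
  qed
  obtain y where y: "d < y" "y < 1" "y \<notin> {y :: real. \<exists>k::int. y = of_int k \<or> y + b = of_int k}"
    using *[OF countable_bad_y \<open>d < 1\<close>] by blast
  obtain x where x: "c < x" "x < 1" "x \<notin> {x :: real. (\<exists>k::int. x = of_int k \<or> x + a = of_int k) \<or>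
    (\<exists>k m :: int. (x - of_int k) * b = (y - of_int m) * a)}"
    using *[OF countable_bad_x \<open>c < 1\<close>] assms(2) by blast
  have "generic x y a b" using x(3) y(3) assms unfolding generic_def by blast
  then show ?thesis using x y by blast
qed

section \<open>The maximal number of visited tiles\<close>

lemma dist_eq_sqrt: "dist p q = sqrt ((fst q - fst p)\<^sup>2 + (snd q - snd p)\<^sup>2)" for p q :: "real \<times> real"
  by (simp add: dist_prod_def dist_real_def power2_commute)

lemma num_visited_le:
  assumes "dist p q = l" "l > 0"
  shows "\<exists>u v :: nat. (real u)\<^sup>2 + (real v)\<^sup>2 < l\<^sup>2 \<and> num_visited (closed_segment p q) \<le> u + v + 3"
proof -
  define a b where "a = fst q - fst p" and "b = snd q - snd p"
  have q: "closed_segment p q = closed_segment (fst p, snd p) (fst p + a, snd p + b)"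
    by (simp add: a_def b_def)
  have l: "l\<^sup>2 = a\<^sup>2 + b\<^sup>2" using dist_eq_sqrt[of p q] unfolding assms(1) by (simp add: a_def b_def)
  show ?thesis unfolding q num_visited_eq_card l
    by (rule card_visited_le) (use l assms(2) in \<open>metis zero_less_power\<close>)
qed

text \<open>\<open>Max\<close> in the definition of \<open>tau\<close> is meaningful only for a
  finite set; a crude bound in terms of \<open>l\<close> suffices.\<close>

lemma finite_num_visited:
  assumes l: "l > 0"
  shows "finite {num_visited (closed_segment p q) | p q. dist p q = l}"
proof (rule finite_subset)
  show "{num_visited (closed_segment p q) | p q. dist p q = l} \<subseteq> {.. 2 * nat \<lceil>l\<rceil> + 3}"
  proof
    fix n assume "n \<in> {num_visited (closed_segment p q) | p q. dist p q = l}"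
    then obtain u v :: nat where uv: "(real u)\<^sup>2 + (real v)\<^sup>2 < l\<^sup>2" "n \<le> u + v + 3"
      using num_visited_le l by blast
    have "(real u)\<^sup>2 < l\<^sup>2" "(real v)\<^sup>2 < l\<^sup>2"
      using uv zero_le_power2[of "real u"] zero_le_power2[of "real v"] by linarith+
    then have "real u < l" "real v < l" using l by (auto intro: power_less_imp_less_base)
    then have "u \<le> nat \<lceil>l\<rceil>" "v \<le> nat \<lceil>l\<rceil>" by linarith+
    then show "n \<in> {..2 * nat \<lceil>l\<rceil> + 3}" using uv by auto
  qed
qed auto

lemma tau_le:
  assumes l: "l > 0"
  shows "\<exists>u v :: nat. (real u)\<^sup>2 + (real v)\<^sup>2 < l\<^sup>2 \<and> tau l \<le> u + v + 3"
proof -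
  have "dist (0, 0) (l, 0 :: real) = l" using l by (simp add: dist_eq_sqrt)
  then have "{num_visited (closed_segment p q) | p q. dist p q = l} \<noteq> {}" by blast
  from Max_in[OF finite_num_visited[OF l] this] show ?thesis
    using num_visited_le l unfolding tau_def by auto
qed

lemma tau_ge:
  fixes u v :: nat
  assumes l: "l > 0" and uv: "(real u)\<^sup>2 + (real v)\<^sup>2 < l\<^sup>2"
  shows "u + v + 3 \<le> tau l"
proof -
  \<comment> \<open>Half of the slack is added to each square, so that the displacement exceeds
    \<open>(u, v)\<close> in both coordinates and still has length \<open>l\<close>.\<close>
  define e where "e = (l\<^sup>2 - (real u)\<^sup>2 - (real v)\<^sup>2) / 2"
  define a b where "a = sqrt ((real u)\<^sup>2 + e)" and "b = sqrt ((real v)\<^sup>2 + e)"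
  have "e > 0" using uv by (simp add: e_def)
  then have a: "a > real u" and b: "b > real v"
    unfolding a_def b_def by (auto intro: real_less_rsqrt)
  have ab: "a\<^sup>2 + b\<^sup>2 = l\<^sup>2" using \<open>e > 0\<close> by (simp add: a_def b_def e_def)
  \<comment> \<open>Starting this close to the upper right corner of the unit square, the segment
    ends beyond \<open>u + 1\<close> horizontally and beyond \<open>v + 1\<close>
    vertically.\<close>
  obtain x y where xy: "max 0 (real u + 1 - a) < x" "x < 1" "max 0 (real v + 1 - b) < y" "y < 1" and
    g: "generic x y a b"
    using ex_generic[of a b "max 0 (real u + 1 - a)" "max 0 (real v + 1 - b)"] a b by auto
  have "\<lfloor>x\<rfloor> = 0" "\<lfloor>y\<rfloor> = 0" "\<lfloor>x + a\<rfloor> \<ge> int u + 1" "\<lfloor>y + b\<rfloor> \<ge> int v + 1"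
    using xy by (auto simp: floor_eq_iff le_floor_iff)
  then have "u + v + 3 \<le> card (visited x y a b)"
    using card_visited_generic[OF g] by linarith
  also have "\<dots> = num_visited (closed_segment (x, y) (x + a, y + b))"
    by (simp add: num_visited_eq_card)
  also have "dist (x, y) (x + a, y + b) = l"
    using ab l by (simp add: dist_eq_sqrt)
  then have "num_visited (closed_segment (x, y) (x + a, y + b)) \<le> tau l"
    unfolding tau_def by (intro Max_ge finite_num_visited l) blast
  finally show "u + v + 3 \<le> tau l" .
qed

subsection \<open>Maximal pairs and the integral over the angle\<close>

text \<open>Evenness and the period carry the second quarter to the first; the period alone carries
  the second half to the first half.\<close>

lemma integral_four_quarters:
  fixes f :: "real \<Rightarrow> real"
  assumes cont: "continuous_on UNIV f" and refl: "\<And>x. f (- x) = f x" and per: "\<And>x. f (x + pi) = f x"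
  shows "integral {0..2 * pi} f = 4 * integral {0..pi / 2} f"
proof -
  have i: "f integrable_on {a..b}" for a b
    by (intro integrable_continuous_real continuous_on_subset[OF cont]) auto
  have s: "integral {a + pi..b + pi} f = integral {a..b} f" for a b
    using integral_shift_real_ivl[of "a + pi" pi "b + pi" f] by (simp add: per)
  have "integral {- (pi / 2)..0} f = integral {0..pi / 2} f"
    using Henstock_Kurzweil_Integration.integral_reflect_real[of "pi / 2" 0 f] by (simp add: refl)
  then have 2: "integral {pi / 2..pi} f = integral {0..pi / 2} f"
    using s[of "- (pi / 2)" 0] by simp
  have 3: "integral {0..pi} f = integral {0..pi / 2} f + integral {pi / 2..pi} f"
    by (intro Henstock_Kurzweil_Integration.integral_combine[symmetric] i) auto
  have "integral {0..2 * pi} f = integral {0..pi} f + integral {pi..2 * pi} f"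
    by (intro Henstock_Kurzweil_Integration.integral_combine[symmetric] i) auto
  then show ?thesis using 2 3 s[of 0 pi] by simp
qed

text \<open>For a maximal pair with \<open>u = i - 2\<close> and \<open>v = j - 2\<close> this will
  be the probability of \<open>crossings l i j\<close> at fixed angle. The positive parts extend the
  integrand of \<open>gfun\<close> continuously to all angles.\<close>

definition overhang :: "real \<Rightarrow> real \<Rightarrow> real \<Rightarrow> real \<Rightarrow> real" where
  "overhang l u v \<theta> = max 0 (l * \<bar>cos \<theta>\<bar> - u) * max 0 (l * \<bar>sin \<theta>\<bar> - v)"

lemma continuous_on_overhang: "continuous_on A (overhang l u v)"
  unfolding overhang_def[abs_def] by (intro continuous_intros)

lemma overhang_nonneg: "0 \<le> overhang l u v \<theta>"
  by (simp add: overhang_def)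

text \<open>The point \<open>(u, v)\<close> lies inside the circle of radius \<open>l\<close>, so
  \<open>v / l\<close> is below the sine of \<open>arccos (u / l)\<close>; \<open>arcsin\<close> is
  increasing.\<close>

lemma arcsin_less_arccos:
  assumes "l > 0" "0 \<le> u" "0 \<le> v" "u\<^sup>2 + v\<^sup>2 < l\<^sup>2"
  shows "arcsin (v / l) < arccos (u / l)"
proof -
  have uv: "u < l" "v < l"
    using assms zero_le_power2[of u] zero_le_power2[of v]
    by (intro power_less_imp_less_base[of _ 2 l]; linarith)+
  have "(v / l)\<^sup>2 < 1 - (u / l)\<^sup>2"
    using assms by (simp add: field_simps)
  then have "v / l < sqrt (1 - (u / l)\<^sup>2)" by (rule real_less_rsqrt)
  also have "\<dots> = sin (arccos (u / l))"
    using uv assms by (intro sin_arccos[symmetric]) (auto simp: field_simps)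
  finally have "arcsin (v / l) < arcsin (sin (arccos (u / l)))"
    using uv assms by (intro arcsin_less_arcsin) (auto simp: field_simps)
  also have "\<dots> = arccos (u / l)"
    using uv assms arccos_le_pi2[of "u / l"] arccos_lbound[of "u / l"] pi_ge_zero
    by (intro arcsin_sin) (auto simp: field_simps)
  finally show ?thesis .
qed

lemma integral_overhang:
  assumes "l > 0" "0 \<le> u" "0 \<le> v" "u\<^sup>2 + v\<^sup>2 < l\<^sup>2"
  shows "integral {0..pi / 2} (overhang l u v) = pi / 2 * gfun l u v"
proof -
  define p q where "p = arcsin (v / l)" and "q = arccos (u / l)"
  have uv: "u < l" "v < l"
    using assms zero_le_power2[of u] zero_le_power2[of v]
    by (intro power_less_imp_less_base[of _ 2 l]; linarith)+
  have uvl: "-1 \<le> u / l" "u / l \<le> 1" "0 \<le> u / l" "-1 \<le> v / l" "v / l \<le> 1" "0 \<le> v / l"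
    using uv assms by (auto simp: field_simps)
  have pq: "0 \<le> p" "p \<le> q" "q \<le> pi / 2"
    using uvl arcsin_less_arccos[OF assms] arccos_le_pi2[of "u / l"]
    by (auto simp: p_def q_def intro!: arcsin_nonneg)
  have "sin p = v / l" "cos q = u / l"
    unfolding p_def q_def using uvl by (auto intro!: sin_arcsin cos_arccos simp only:)
  then have sinp: "l * sin p = v" and cosq: "l * cos q = u"
    using assms(1) by auto
  have pos: "0 \<le> sin \<theta>" "0 \<le> cos \<theta>" if "0 \<le> \<theta>" "\<theta> \<le> pi / 2" for \<theta>
    using that by (auto intro: sin_ge_zero cos_ge_zero)
  have mono: "sin x \<le> sin y" "cos y \<le> cos x" if "0 \<le> x" "x \<le> y" "y \<le> pi / 2" for x y
    using that by (auto intro: sin_monotone_2pi_le cos_monotone_0_pi_le)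
  have i: "overhang l u v integrable_on {a..b}" for a b
    by (intro integrable_continuous_real continuous_on_overhang)
  have "integral {0..p} (overhang l u v) = integral {0..p} (\<lambda>_. 0)"
  proof (rule integral_cong)
    fix x assume x: "x \<in> {0..p}"
    then have "l * sin x \<le> l * sin p" using mono(1)[of x p] pq assms by (intro mult_left_mono) auto
    then show "overhang l u v x = 0" using sinp x pos[of x] pq by (simp add: overhang_def)
  qed
  moreover have "integral {q..pi / 2} (overhang l u v) = integral {q..pi / 2} (\<lambda>_. 0)"
  proof (rule integral_cong)
    fix x assume x: "x \<in> {q..pi / 2}"
    then have "l * cos x \<le> l * cos q" using mono(2)[of q x] pq assms by (intro mult_left_mono) auto
    then show "overhang l u v x = 0" using cosq x pos[of x] pq by (simp add: overhang_def)
  qed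
  moreover have "integral {p..q} (overhang l u v)
      = integral {p..q} (\<lambda>\<theta>. (l * cos \<theta> - u) * (l * sin \<theta> - v))"
  proof (rule integral_cong)
    fix x assume x: "x \<in> {p..q}"
    then have "l * cos q \<le> l * cos x" "l * sin p \<le> l * sin x"
      using mono[of x q] mono[of p x] pq assms by (auto intro!: mult_left_mono)
    then show "overhang l u v x = (l * cos x - u) * (l * sin x - v)"
      using sinp cosq x pos[of x] pq by (simp add: overhang_def)
  qed
  moreover have "integral {0..pi / 2} (overhang l u v) =
      integral {0..p} (overhang l u v) + integral {p..pi / 2} (overhang l u v)"
    "integral {p..pi / 2} (overhang l u v) =
      integral {p..q} (overhang l u v) + integral {q..pi / 2} (overhang l u v)"
    using pq by (auto intro!: Henstock_Kurzweil_Integration.integral_combine[symmetric] i)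
  ultimately show ?thesis by (simp add: gfun_def p_def q_def)
qed

text \<open>Substituting \<open>pi / 2 - \<theta>\<close> exchanges sine and cosine; it is done as a
  reflection followed by a shift.\<close>

lemma gfun_sym:
  assumes "\<bar>u / s\<bar> \<le> 1" "\<bar>v / s\<bar> \<le> 1"
  shows "gfun s u v = gfun s v u"
proof -
  let ?f = "\<lambda>\<theta>. (s * cos \<theta> - u) * (s * sin \<theta> - v)"
  have "integral {arcsin (v / s)..arccos (u / s)} ?f =
    integral {- arccos (u / s)..- arcsin (v / s)} (\<lambda>\<theta>. ?f (- \<theta>))"
    by (rule Henstock_Kurzweil_Integration.integral_reflect_real[symmetric])
  also have "\<dots> = integral {- arccos (u / s) + pi / 2 - pi / 2..- arcsin (v / s) + pi / 2 - pi / 2}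
      (\<lambda>\<theta>. (s * cos (\<theta> + pi / 2) - v) * (s * sin (\<theta> + pi / 2) - u))"
    by (simp add: cos_add sin_add mult.commute)
  also have "\<dots> = integral {- arccos (u / s) + pi / 2..- arcsin (v / s) + pi / 2}
      (\<lambda>\<theta>. (s * cos \<theta> - v) * (s * sin \<theta> - u))"
    by (rule integral_shift_real_ivl)
  also have "- arccos (u / s) + pi / 2 = arcsin (u / s)"
    using arcsin_arccos_eq[of "u / s"] assms(1) by linarith
  also have "- arcsin (v / s) + pi / 2 = arccos (v / s)"
    using arcsin_arccos_eq[of "v / s"] assms(2) by linarith
  finally show ?thesis by (simp add: gfun_def)
qed

text \<open>The floor of \<open>x\<close> is 0 here, so the set is a possibly empty interval, at the
  right end for positive \<open>c\<close> and at the left end for negative \<open>c\<close>. The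
  upper bound on \<open>\<bar>c\<bar>\<close> keeps the floor difference from exceeding
  \<open>i - 1\<close>.\<close>

lemma emeasure_shift_floor:
  fixes c :: real and i :: int
  assumes "i \<ge> 2" "\<bar>c\<bar> \<le> of_int i - 1"
  shows "emeasure lborel ({0..<1} \<inter> {x. \<bar>\<lfloor>x + c\<rfloor> - \<lfloor>x\<rfloor>\<bar> = i - 1}) = ennreal (max 0 (\<bar>c\<bar> - of_int (i - 2)))"
    (is "emeasure lborel ?A = _")
proof -
  have fl: "\<lfloor>x\<rfloor> = 0" if "0 \<le> x" "x < 1" for x :: real using that by linarith
  consider "\<bar>c\<bar> \<le> of_int (i - 2)" | "c > of_int (i - 2)" | "- c > of_int (i - 2)" by linarith
  then show ?thesis
  proof cases
    case 1
    then have "?A = {}" by (auto simp: fl) linarith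
    then show ?thesis using 1 by simp
  next
    case 2
    then have "?A = {of_int i - 1 - c..<1}"
      using assms by (intro set_eqI iffI) (auto simp: fl, linarith+)
    then show ?thesis using 2 assms by simp
  next
    case 3
    then have "?A = {0..<- c - of_int (i - 2)}"
      using assms by (intro set_eqI iffI) (auto simp: fl, linarith+)
    then show ?thesis using 3 assms by simp
  qed
qed

section \<open>Column and row counts that realise the maximum\<close>

definition max_pairs :: "real \<Rightarrow> (int \<times> int) set" where
  "max_pairs l = {(i :: int, j :: int). i \<ge> 2 \<and> j \<ge> 2 \<and> i + j - 1 = int (tau l) \<and>
      real_of_int ((i - 2)\<^sup>2 + (j - 2)\<^sup>2) < l\<^sup>2}"

lemma mem_max_pairs [simp]:
  "(i, j) \<in> max_pairs l \<longleftrightarrow> i \<ge> 2 \<and> j \<ge> 2 \<and> i + j - 1 = int (tau l) \<and>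
     real_of_int ((i - 2)\<^sup>2 + (j - 2)\<^sup>2) < l\<^sup>2"
  by (simp add: max_pairs_def)

lemma finite_max_pairs: "finite (max_pairs l)"
  by (rule finite_subset[of _ "{2..int (tau l)} \<times> {2..int (tau l)}"]) auto

lemma tau_ge_int:
  fixes i j :: int
  assumes "l > 0" "i \<ge> 0" "j \<ge> 0" "(real_of_int i)\<^sup>2 + (real_of_int j)\<^sup>2 < l\<^sup>2"
  shows "i + j + 3 \<le> int (tau l)"
  using tau_ge[of l "nat i" "nat j"] assms by simp

lemma card_visited_eq_tau_iff:
  assumes "l > 0" and g: "generic x y a b" and ab: "a\<^sup>2 + b\<^sup>2 = l\<^sup>2"
  shows "card (visited x y a b) = tau l \<longleftrightarrow>
    (\<exists>(i, j)\<in>max_pairs l. \<bar>\<lfloor>x + a\<rfloor> - \<lfloor>x\<rfloor>\<bar> = i - 1 \<and> \<bar>\<lfloor>y + b\<rfloor> - \<lfloor>y\<rfloor>\<bar> = j - 1)"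
proof -
  define i j where "i = \<bar>\<lfloor>x + a\<rfloor> - \<lfloor>x\<rfloor>\<bar> + 1" and "j = \<bar>\<lfloor>y + b\<rfloor> - \<lfloor>y\<rfloor>\<bar> + 1"
  have c: "int (card (visited x y a b)) = i + j - 1"
    using card_visited_generic[OF g] by (simp add: i_def j_def)
  have a: "real_of_int (i - 2) < \<bar>a\<bar>" and b: "real_of_int (j - 2) < \<bar>b\<bar>"
    unfolding i_def j_def by linarith+
  have ij1: "i \<ge> 1" "j \<ge> 1" by (auto simp: i_def j_def)
  have sq: "(real_of_int n)\<^sup>2 < c\<^sup>2" if "real_of_int n < \<bar>c\<bar>" "n \<ge> 0" for n and c :: real
    using power_strict_mono[OF that(1), of 2] that(2) by simp
  have "(i, j) \<in> max_pairs l" if t: "i + j - 1 = int (tau l)"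
  proof -
    have t3: "int (tau l) \<ge> 3" using tau_ge_int[of l 0 0] assms(1) by simp
    \<comment> \<open>A single column would mean \<open>j = tau l\<close> and
      \<open>j - 2 < l\<close>, but then \<open>tau_ge_int\<close> for the pair
      \<open>(0, j - 2)\<close> yields \<open>j + 1 \<le> tau l\<close>.\<close>
    have "i \<noteq> 1"
    proof
      assume "i = 1"
      then have "(real_of_int (j - 2))\<^sup>2 < b\<^sup>2" using b t t3 by (intro sq) auto
      also have "\<dots> \<le> l\<^sup>2" using ab zero_le_power2[of a] by linarith
      finally show False using tau_ge_int[of l 0 "j - 2"] \<open>i = 1\<close> t t3 assms(1) by simp
    qed
    moreover have "j \<noteq> 1"
    proof
      assume "j = 1"
      then have "(real_of_int (i - 2))\<^sup>2 < a\<^sup>2" using a t t3 by (intro sq) auto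
      also have "\<dots> \<le> l\<^sup>2" using ab zero_le_power2[of b] by linarith
      finally show False using tau_ge_int[of l "i - 2" 0] \<open>j = 1\<close> t t3 assms(1) by simp
    qed
    ultimately have "i \<ge> 2" "j \<ge> 2" using ij1 by auto
    then show ?thesis using t sq[OF a] sq[OF b] ab by simp
  qed
  then have "card (visited x y a b) = tau l \<longleftrightarrow> (i, j) \<in> max_pairs l" using c by auto
  also have "\<dots> \<longleftrightarrow> (\<exists>(i', j')\<in>max_pairs l. i - 1 = i' - 1 \<and> j - 1 = j' - 1)"
    by auto
  finally show ?thesis by (simp only: i_def j_def add_diff_cancel_right')
qed

text \<open>Otherwise \<open>(i - 1, j - 2)\<close> would be admissible in \<open>tau_ge_int\<close>
  and give \<open>i + j \<le> tau l\<close>, one too many.\<close>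

lemma max_pairs_bound:
  assumes "l > 0" "(i, j) \<in> max_pairs l" "a\<^sup>2 + b\<^sup>2 = l\<^sup>2" "of_int (j - 2) < \<bar>b\<bar>"
  shows "\<bar>a\<bar> \<le> real_of_int i - 1"
proof (rule ccontr)
  assume "\<not> ?thesis"
  then have "(real_of_int (i - 1))\<^sup>2 \<le> \<bar>a\<bar>\<^sup>2" "(real_of_int (j - 2))\<^sup>2 < \<bar>b\<bar>\<^sup>2"
    using assms(2,4) by (intro power_mono power_strict_mono; auto)+
  then have "(real_of_int (i - 1))\<^sup>2 + (real_of_int (j - 2))\<^sup>2 < l\<^sup>2"
    using assms(3) by (simp only: power2_abs)
  then show False using tau_ge_int[of l "i - 1" "j - 2"] assms by simp
qed

lemma max_pairs_swap: "(i, j) \<in> max_pairs l \<Longrightarrow> (j, i) \<in> max_pairs l"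
  by (auto simp: add.commute)

text \<open>If one overhang is not positive, its factor is zero whatever the other is. If both are
  positive, \<open>max_pairs_bound\<close> supplies the range required by
  \<open>emeasure_shift_floor\<close>.\<close>

lemma emeasure_shift_floor_prod:
  assumes "l > 0" "(i, j) \<in> max_pairs l" "a\<^sup>2 + b\<^sup>2 = l\<^sup>2"
  shows "emeasure lborel ({0..<1} \<inter> {y. \<bar>\<lfloor>y + b\<rfloor> - \<lfloor>y\<rfloor>\<bar> = j - 1}) *
      emeasure lborel ({0..<1} \<inter> {x. \<bar>\<lfloor>x + a\<rfloor> - \<lfloor>x\<rfloor>\<bar> = i - 1})
    = ennreal (max 0 (\<bar>a\<bar> - of_int (i - 2)) * max 0 (\<bar>b\<bar> - of_int (j - 2)))"
proof -
  have ij: "i \<ge> 2" "j \<ge> 2" using assms(2) by auto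
  consider "\<bar>a\<bar> \<le> of_int (i - 2)" | "\<bar>b\<bar> \<le> of_int (j - 2)"
    | "\<bar>a\<bar> > of_int (i - 2)" "\<bar>b\<bar> > of_int (j - 2)" by linarith
  then show ?thesis
  proof cases
    case 1
    then show ?thesis using emeasure_shift_floor[of i a] ij by simp
  next
    case 2
    then show ?thesis using emeasure_shift_floor[of j b] ij by simp
  next
    case 3
    then have "\<bar>a\<bar> \<le> real_of_int i - 1" "\<bar>b\<bar> \<le> real_of_int j - 1"
      using max_pairs_bound[OF assms] max_pairs_bound[OF assms(1) max_pairs_swap[OF assms(2)], of b a] assms(3)
      by (auto simp: add.commute)
    then show ?thesis using emeasure_shift_floor[of i a] emeasure_shift_floor[of j b] ij
      by (simp add: ennreal_mult mult.commute)
  qed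
qed

subsection \<open>The random segment\<close>

abbreviation unif :: "real \<Rightarrow> real \<Rightarrow> real measure" where
  "unif a b \<equiv> uniform_measure lborel {a..<b}"

text \<open>The angle comes first so that Fubini integrates over starting points at fixed angle;
  \<open>y\<close> precedes \<open>x\<close> because \<open>countable_bad_x\<close> has
  \<open>y\<close> fixed.\<close>

abbreviation configs :: "(real \<times> real \<times> real) measure" where
  "configs \<equiv> unif 0 (2 * pi) \<Otimes>\<^sub>M (unif 0 1 \<Otimes>\<^sub>M unif 0 1)"

lemma prob_space_unif: "a < b \<Longrightarrow> prob_space (unif a b)"
  by (intro prob_space_uniform_measure) auto

lemma sets_configs: "sets configs = sets borel"
  by (simp only: borel_prod[symmetric] cong: sets_pair_measure_cong) (intro sets_pair_measure_cong; simp)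

lemma pair_sigma_finite_unif: "pair_sigma_finite (unif 0 1) (unif 0 1)"
  unfolding pair_sigma_finite_def by (intro conjI prob_space_imp_sigma_finite prob_space_unif) auto

lemma prob_space_unif_pair: "prob_space (unif 0 1 \<Otimes>\<^sub>M unif 0 1)"
  by (intro prob_space_pair prob_space_unif) auto

lemma pair_sigma_finite_configs: "pair_sigma_finite (unif 0 (2 * pi)) (unif 0 1 \<Otimes>\<^sub>M unif 0 1)"
  unfolding pair_sigma_finite_def
  by (intro conjI prob_space_imp_sigma_finite prob_space_unif_pair prob_space_unif) auto

lemma prob_space_configs: "prob_space configs"
  by (intro prob_space_pair prob_space_unif_pair prob_space_unif) auto

lemma AE_unif_countable:
  assumes "countable A"
  shows "AE x in unif a b. x \<notin> A"
  by (rule AE_uniform_measureI) (use AE_not_in[OF countable_imp_null_set_lborel[OF assms]] in auto)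

lemma countable_sin_cos_zero: "countable {\<theta> :: real. sin \<theta> = 0 \<or> cos \<theta> = 0}"
proof (rule countable_subset)
  show "{\<theta> :: real. sin \<theta> = 0 \<or> cos \<theta> = 0} \<subseteq> range (\<lambda>n::int. of_int n * (pi / 2))"
    by (auto simp: sin_zero_iff_int cos_zero_iff_int)
qed auto

lemma sets_generic: "{(\<theta>, y, x). generic x y (l * cos \<theta>) (l * sin \<theta>)} \<in> sets borel"
proof -
  have "{z \<in> space (borel \<Otimes>\<^sub>M borel \<Otimes>\<^sub>M borel). generic (snd (snd z)) (fst (snd z)) (l * cos (fst z)) (l * sin (fst z))}
      \<in> sets (borel \<Otimes>\<^sub>M borel \<Otimes>\<^sub>M borel)"
    unfolding generic_def by measurable
  then show ?thesis unfolding case_prod_unfold borel_prod[symmetric] by (simp add: space_pair_measure)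
qed

text \<open>One coordinate at a time: the angle avoids the axis directions, then \<open>y\<close>
  and finally \<open>x\<close> avoid countable, hence null, sets.\<close>

lemma AE_generic:
  assumes "l > 0"
  shows "AE (\<theta>, y, x) in configs. generic x y (l * cos \<theta>) (l * sin \<theta>)"
proof (rule pair_sigma_finite.AE_pair_measure[OF pair_sigma_finite_configs])
  show "{z \<in> space configs. case z of (\<theta>, y, x) \<Rightarrow> generic x y (l * cos \<theta>) (l * sin \<theta>)} \<in> sets configs"
    using sets_generic[of l] unfolding sets_configs by (simp add: space_pair_measure)
  show "AE \<theta> in unif 0 (2 * pi). AE z in unif 0 1 \<Otimes>\<^sub>M unif 0 1.
      case (\<theta>, z) of (\<theta>, y, x) \<Rightarrow> generic x y (l * cos \<theta>) (l * sin \<theta>)"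
    using AE_unif_countable[OF countable_sin_cos_zero]
  proof eventually_elim
    fix \<theta> :: real assume \<theta>: "\<theta> \<notin> {\<theta>. sin \<theta> = 0 \<or> cos \<theta> = 0}"
    define a b where "a = l * cos \<theta>" and "b = l * sin \<theta>"
    have nz: "a \<noteq> 0" "b \<noteq> 0" using \<theta> assms by (auto simp: a_def b_def)
    have "AE (y, x) in unif 0 1 \<Otimes>\<^sub>M unif 0 1. generic x y a b"
    proof (rule pair_sigma_finite.AE_pair_measure[OF pair_sigma_finite_unif])
      have "{z \<in> space (borel \<Otimes>\<^sub>M borel). generic (snd z) (fst z) a b} \<in> sets (borel \<Otimes>\<^sub>M borel)"
        unfolding generic_def by measurable
      moreover have "sets (unif 0 1 \<Otimes>\<^sub>M unif 0 1) = sets (borel \<Otimes>\<^sub>M borel)"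
        by (intro sets_pair_measure_cong) auto
      ultimately show "{z \<in> space (unif 0 1 \<Otimes>\<^sub>M unif 0 1). case z of (y, x) \<Rightarrow> generic x y a b}
          \<in> sets (unif 0 1 \<Otimes>\<^sub>M unif 0 1)"
        by (simp add: space_pair_measure case_prod_beta)
      show "AE y in unif 0 1. AE x in unif 0 1. case (y, x) of (y, x) \<Rightarrow> generic x y a b"
        using AE_unif_countable[OF countable_bad_y[of b]]
      proof eventually_elim
        fix y assume y: "y \<notin> {y :: real. \<exists>k::int. y = of_int k \<or> y + b = of_int k}"
        show "AE x in unif 0 1. case (y, x) of (y, x) \<Rightarrow> generic x y a b"
          using AE_unif_countable[OF countable_bad_x[OF nz(2), of a y]]
          by eventually_elim (use y nz in \<open>auto simp: generic_def\<close>)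
      qed
    qed
    then show "AE z in unif 0 1 \<Otimes>\<^sub>M unif 0 1.
      case (\<theta>, z) of (\<theta>, y, x) \<Rightarrow> generic x y (l * cos \<theta>) (l * sin \<theta>)"
      by (simp add: a_def b_def)
  qed
qed

lemma num_visited_segment_at:
  "num_visited (segment_at l x y \<theta>) = card (visited x y (l * cos \<theta>) (l * sin \<theta>))"
  by (simp add: segment_at_def num_visited_eq_card)

text \<open>Visiting a given tile is an open condition on the configuration.\<close>

lemma sets_num_visited: "{(\<theta>, y, x). num_visited (segment_at l x y \<theta>) = n} \<in> sets borel"
proof -
  let ?V = "\<lambda>z :: real \<times> real \<times> real. visited (snd (snd z)) (fst (snd z)) (l * cos (fst z)) (l * sin (fst z))"
  have V: "{z. p \<in> ?V z} \<in> sets borel" for p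
  proof -
    obtain k m where p: "p = (k, m)" by force
    have "{z. p \<in> ?V z} = (\<Union>s\<in>{0..1}. {z.
       of_int k < snd (snd z) + s * (l * cos (fst z)) \<and> snd (snd z) + s * (l * cos (fst z)) < of_int k + 1 \<and>
       of_int m < fst (snd z) + s * (l * sin (fst z)) \<and> fst (snd z) + s * (l * sin (fst z)) < of_int m + 1})"
      by (auto simp: p visited_def)
    also have "open \<dots>"
      by (intro open_UN ballI open_Collect_conj open_Collect_less continuous_intros)
    finally show ?thesis by (rule borel_open)
  qed
  \<comment> \<open>\<open>measurable_card\<close> concerns sets of naturals, so the index pairs are
    encoded by the injective \<open>to_nat\<close>, which preserves the cardinality.\<close>
  have "(\<lambda>z. card (to_nat ` ?V z)) \<in> measurable borel (count_space UNIV)"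
  proof (rule measurable_card)
    fix i
    have "{z \<in> space borel. i \<in> to_nat ` ?V z} = (\<Union>p\<in>{p. to_nat p = i}. {z. p \<in> ?V z})" by auto
    also have "\<dots> \<in> sets borel" by (intro sets.countable_UN'' V countableI_type)
    finally show "{z \<in> space borel. i \<in> to_nat ` ?V z} \<in> sets borel" .
  qed
  then have "(\<lambda>z. card (to_nat ` ?V z)) -` {n} \<inter> space borel \<in> sets borel"
    by (rule measurable_sets) auto
  also have "(\<lambda>z. card (to_nat ` ?V z)) -` {n} \<inter> space borel
      = {(\<theta>, y, x). num_visited (segment_at l x y \<theta>) = n}"
    by (auto simp: num_visited_segment_at card_image)
  finally show ?thesis .
qed

text \<open>In general position these configurations meet \<open>i\<close> columns and
  \<open>j\<close> rows: each count exceeds the number of crossed lines by one.\<close>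

definition crossings :: "real \<Rightarrow> int \<Rightarrow> int \<Rightarrow> (real \<times> real \<times> real) set" where
  "crossings l i j = {(\<theta>, y, x). \<bar>\<lfloor>x + l * cos \<theta>\<rfloor> - \<lfloor>x\<rfloor>\<bar> = i - 1 \<and> \<bar>\<lfloor>y + l * sin \<theta>\<rfloor> - \<lfloor>y\<rfloor>\<bar> = j - 1}"

lemma sets_crossings: "crossings l i j \<in> sets borel"
proof -
  have "{z \<in> space (borel \<Otimes>\<^sub>M borel \<Otimes>\<^sub>M borel). \<bar>\<lfloor>snd (snd z) + l * cos (fst z)\<rfloor> - \<lfloor>snd (snd z)\<rfloor>\<bar> = i - 1 \<and>
    \<bar>\<lfloor>fst (snd z) + l * sin (fst z)\<rfloor> - \<lfloor>fst (snd z)\<rfloor>\<bar> = j - 1}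
    \<in> sets (borel \<Otimes>\<^sub>M borel \<Otimes>\<^sub>M borel)"
    by measurable
  then show ?thesis unfolding crossings_def case_prod_unfold borel_prod[symmetric]
    by (simp add: space_pair_measure)
qed

lemma sets_shift_floor: "{x :: real. \<bar>\<lfloor>x + c\<rfloor> - \<lfloor>x\<rfloor>\<bar> = i} \<in> sets borel"
  by measurable

text \<open>At fixed angle the section is a product of two sets whose measures multiply to
  \<open>overhang\<close>. Over the angle, each of the four quarters contributes
  \<open>pi / 2 * gfun\<close>, against the total length \<open>2 * pi\<close>.\<close>

lemma measure_crossings:
  assumes "l > 0" "(i, j) \<in> max_pairs l"
  shows "measure configs (crossings l i j) = gfun l (of_int (i - 2)) (of_int (j - 2))"
proof -
  interpret P: prob_space "unif 0 1 \<Otimes>\<^sub>M unif 0 1" by (rule prob_space_unif_pair)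
  interpret Q: prob_space "unif 0 1" by (rule prob_space_unif) simp
  let ?u = "real_of_int (i - 2)" and ?v = "real_of_int (j - 2)"
  let ?F = "overhang l ?u ?v"
  have uv: "0 \<le> ?u" "0 \<le> ?v" "?u\<^sup>2 + ?v\<^sup>2 < l\<^sup>2" using assms(2) by auto
  have int: "(?F has_integral integral {0..2 * pi} ?F) {0..2 * pi}"
    by (intro integrable_integral integrable_continuous_real continuous_on_overhang)
  have "integral {0..2 * pi} ?F = 4 * integral {0..pi / 2} ?F"
    by (intro integral_four_quarters continuous_on_overhang) (simp_all add: overhang_def)
  then have quarter: "integral {0..2 * pi} ?F = 2 * pi * gfun l ?u ?v"
    using integral_overhang[OF assms(1) uv] by simp
  have "0 \<le> 2 * pi * gfun l ?u ?v"
    unfolding quarter[symmetric] by (intro integral_nonneg has_integral_integrable[OF int] overhang_nonneg)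
  then have nonneg: "0 \<le> gfun l ?u ?v" by (simp add: zero_le_mult_iff not_le[THEN iffD2, OF pi_gt_zero])
  have sec: "emeasure (unif 0 1 \<Otimes>\<^sub>M unif 0 1) (Pair \<theta> -` crossings l i j) = ennreal (?F \<theta>)" for \<theta>
  proof -
    let ?A = "\<lambda>c i. {x. \<bar>\<lfloor>x + c\<rfloor> - \<lfloor>x :: real\<rfloor>\<bar> = i - 1}"
    have "Pair \<theta> -` crossings l i j = ?A (l * sin \<theta>) j \<times> ?A (l * cos \<theta>) i"
      by (auto simp: crossings_def)
    then have "emeasure (unif 0 1 \<Otimes>\<^sub>M unif 0 1) (Pair \<theta> -` crossings l i j)
       = emeasure (unif 0 1) (?A (l * sin \<theta>) j) * emeasure (unif 0 1) (?A (l * cos \<theta>) i)"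
      using Q.emeasure_pair_measure_Times[of "?A (l * sin \<theta>) j" "unif 0 1" "?A (l * cos \<theta>) i"]
      by (simp add: sets_shift_floor)
    also have "\<dots> = emeasure lborel ({0..<1} \<inter> ?A (l * sin \<theta>) j) * emeasure lborel ({0..<1} \<inter> ?A (l * cos \<theta>) i)"
      by (simp add: sets_shift_floor divide_ennreal_def)
    also have "\<dots> = ennreal (?F \<theta>)"
    proof -
      have "(l * cos \<theta>)\<^sup>2 + (l * sin \<theta>)\<^sup>2 = l\<^sup>2"
        by (simp add: power_mult_distrib flip: distrib_left)
      from emeasure_shift_floor_prod[OF assms this] show ?thesis
        using assms(1) by (simp add: overhang_def abs_mult)
    qed
    finally show ?thesis .
  qed
  have "emeasure configs (crossings l i j) = (\<integral>\<^sup>+\<theta>. ennreal (?F \<theta>) \<partial>unif 0 (2 * pi))"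
    using P.emeasure_pair_measure_alt[of "crossings l i j" "unif 0 (2 * pi)", unfolded sets_configs,
        OF sets_crossings]
    by (simp only: sec)
  also have "\<dots> = (\<integral>\<^sup>+\<theta>. ennreal (?F \<theta>) * indicator {0..<2 * pi} \<theta> \<partial>lborel) / emeasure lborel {0..<2 * pi}"
  proof (rule nn_integral_uniform_measure)
    have "?F \<in> borel_measurable borel"
      by (intro borel_measurable_continuous_onI continuous_on_overhang)
    then show "(\<lambda>\<theta>. ennreal (?F \<theta>)) \<in> borel_measurable lborel" by simp
  qed simp
  \<comment> \<open>The has-integral fact lives on the closed interval, which differs from the
    half-open one by a null set.\<close>
  also have "(\<integral>\<^sup>+\<theta>. ennreal (?F \<theta>) * indicator {0..<2 * pi} \<theta> \<partial>lborel)
      = (\<integral>\<^sup>+\<theta>. ennreal (?F \<theta>) * indicator {0..2 * pi} \<theta> \<partial>lborel)"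
    by (rule nn_integral_cong_AE, use AE_lborel_singleton[of "2 * pi"] in eventually_elim)
       (auto simp: indicator_def)
  also have "\<dots> = ennreal (2 * pi * gfun l ?u ?v)"
    using nn_integral_has_integral_lebesgue'[OF overhang_nonneg int] by (simp only: quarter)
  also have "\<dots> / emeasure lborel {0..<2 * pi} = ennreal (gfun l ?u ?v)"
    using nonneg by (simp add: divide_ennreal)
  finally show ?thesis using nonneg by (simp add: measure_def)
qed

text \<open>Off the null set of non-generic configurations the event is a union of
  \<open>crossings\<close> over maximal pairs, disjoint because a configuration determines its floor
  differences.\<close>

lemma measure_num_visited_eq_tau:
  assumes "l > 0"
  shows "measure configs {(\<theta>, y, x). num_visited (segment_at l x y \<theta>) = tau l} =
    (\<Sum>(i, j)\<in>max_pairs l. gfun l (of_int (i - 2)) (of_int (j - 2)))"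
proof -
  interpret prob_space configs by (rule prob_space_configs)
  have "measure configs {(\<theta>, y, x). num_visited (segment_at l x y \<theta>) = tau l}
      = measure configs (\<Union>(i, j)\<in>max_pairs l. crossings l i j)"
  proof (rule finite_measure_eq_AE)
    show "AE z in configs. (z \<in> {(\<theta>, y, x). num_visited (segment_at l x y \<theta>) = tau l})
       \<longleftrightarrow> (z \<in> (\<Union>(i, j)\<in>max_pairs l. crossings l i j))"
      using AE_generic[OF assms]
    proof eventually_elim
      case (elim z)
      obtain \<theta> y x where z: "z = (\<theta>, y, x)" by (cases z) auto
      have "(l * cos \<theta>)\<^sup>2 + (l * sin \<theta>)\<^sup>2 = l\<^sup>2"
        by (simp add: power_mult_distrib flip: distrib_left)
      with elim z have "card (visited x y (l * cos \<theta>) (l * sin \<theta>)) = tau l \<longleftrightarrow>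
        (\<exists>(i, j)\<in>max_pairs l. \<bar>\<lfloor>x + l * cos \<theta>\<rfloor> - \<lfloor>x\<rfloor>\<bar> = i - 1 \<and> \<bar>\<lfloor>y + l * sin \<theta>\<rfloor> - \<lfloor>y\<rfloor>\<bar> = j - 1)"
        by (intro card_visited_eq_tau_iff assms) auto
      also have "\<dots> \<longleftrightarrow> z \<in> (\<Union>(i, j)\<in>max_pairs l. crossings l i j)"
        unfolding z crossings_def by blast
      finally show ?case by (simp add: z num_visited_segment_at)
    qed
    show "(\<Union>(i, j)\<in>max_pairs l. crossings l i j) \<in> sets configs"
      unfolding sets_configs by (intro sets.finite_UN finite_max_pairs) (auto intro: sets_crossings)
  qed (simp only: sets_configs sets_num_visited)
  also have "\<dots> = (\<Sum>p\<in>max_pairs l. measure configs (case p of (i, j) \<Rightarrow> crossings l i j))"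
  proof (rule finite_measure_finite_Union[OF finite_max_pairs])
    show "(\<lambda>(i, j). crossings l i j) ` max_pairs l \<subseteq> sets configs"
      unfolding sets_configs by (auto intro: sets_crossings)
    show "disjoint_family_on (\<lambda>(i, j). crossings l i j) (max_pairs l)"
      by (auto simp: disjoint_family_on_def crossings_def)
  qed
  also have "\<dots> = (\<Sum>(i, j)\<in>max_pairs l. gfun l (of_int (i - 2)) (of_int (j - 2)))"
    by (intro sum.cong refl) (use measure_crossings[OF assms] in auto)
  finally show ?thesis .
qed

section \<open>Joint law of the independent uniform variables\<close>

text \<open>\<open>indep_var_restrict\<close> delivers independent restrictions of a family to index
  sets; \<open>f\<close> and \<open>g\<close> serve to read off the components.\<close>

lemma (in prob_space) indep_var_distr_compose:
  assumes "indep_var N1 Z1 N2 Z2" and f[measurable]: "f \<in> measurable N1 S1" and g[measurable]: "g \<in> measurable N2 S2"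
  shows "distr M S1 (\<lambda>\<omega>. f (Z1 \<omega>)) \<Otimes>\<^sub>M distr M S2 (\<lambda>\<omega>. g (Z2 \<omega>)) =
    distr M (S1 \<Otimes>\<^sub>M S2) (\<lambda>\<omega>. (f (Z1 \<omega>), g (Z2 \<omega>)))"
proof -
  have Z[measurable]: "Z1 \<in> measurable M N1" "Z2 \<in> measurable M N2"
    and eq: "distr M N1 Z1 \<Otimes>\<^sub>M distr M N2 Z2 = distr M (N1 \<Otimes>\<^sub>M N2) (\<lambda>\<omega>. (Z1 \<omega>, Z2 \<omega>))"
    using assms(1) unfolding indep_var_distribution_eq by auto
  have "sigma_finite_measure (distr (distr M N2 Z2) S2 g)"
    by (intro prob_space_imp_sigma_finite prob_space.prob_space_distr prob_space_distr) auto
  then have "distr (distr M N1 Z1) S1 f \<Otimes>\<^sub>M distr (distr M N2 Z2) S2 g =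
      distr (distr M N1 Z1 \<Otimes>\<^sub>M distr M N2 Z2) (S1 \<Otimes>\<^sub>M S2) (\<lambda>(x, y). (f x, g y))"
    by (intro pair_measure_distr) auto
  then show ?thesis
    unfolding eq by (simp add: distr_distr comp_def)
qed

lemma distr_configs:
  fixes M :: "'a measure" and X Y \<Theta> :: "'a \<Rightarrow> real"
  assumes "prob_space M"
    and ind: "prob_space.indep_vars M (\<lambda>_. borel) (\<lambda>i. [X, Y, \<Theta>] ! i) {0, 1, 2}"
    and X: "distr M lborel X = unif 0 1" and Y: "distr M lborel Y = unif 0 1"
    and T: "distr M lborel \<Theta> = unif 0 (2 * pi)"
  shows "(\<lambda>\<omega>. (\<Theta> \<omega>, Y \<omega>, X \<omega>)) \<in> measurable M borel"
    and "distr M borel (\<lambda>\<omega>. (\<Theta> \<omega>, Y \<omega>, X \<omega>)) = configs"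
proof -
  interpret prob_space M by fact
  have rv: "[X, Y, \<Theta>] ! i \<in> measurable M borel" if "i \<in> {0, 1, 2}" for i
    using ind that unfolding indep_vars_def by blast
  have "X \<in> borel_measurable M" "Y \<in> borel_measurable M" "\<Theta> \<in> borel_measurable M"
    using rv[of 0] rv[of 1] rv[of 2] by auto
  then show "(\<lambda>\<omega>. (\<Theta> \<omega>, Y \<omega>, X \<omega>)) \<in> measurable M borel"
    unfolding borel_prod[symmetric] by measurable
  have b: "distr M borel Z = distr M lborel Z" for Z :: "'a \<Rightarrow> real"
    by (rule distr_cong) auto
  \<comment> \<open>Independence is used in two groupings: \<open>Y\<close> against
    \<open>X\<close>, then \<open>\<Theta>\<close> against the pair of both.\<close>
  have YX: "distr M borel Y \<Otimes>\<^sub>M distr M borel X = distr M (borel \<Otimes>\<^sub>M borel) (\<lambda>\<omega>. (Y \<omega>, X \<omega>))"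
    using indep_var_distr_compose[OF indep_var_restrict[OF ind, of "{1}" "{0}"],
        of "\<lambda>h. h 1" borel "\<lambda>h. h 0" borel] by simp
  have TYX: "distr M borel \<Theta> \<Otimes>\<^sub>M distr M (borel \<Otimes>\<^sub>M borel) (\<lambda>\<omega>. (Y \<omega>, X \<omega>)) =
      distr M (borel \<Otimes>\<^sub>M (borel \<Otimes>\<^sub>M borel)) (\<lambda>\<omega>. (\<Theta> \<omega>, Y \<omega>, X \<omega>))"
    using indep_var_distr_compose[OF indep_var_restrict[OF ind, of "{2}" "{0, 1}"],
        of "\<lambda>h. h 2" borel "\<lambda>h. (h 1, h 0)" "borel \<Otimes>\<^sub>M borel"] by simp
  have "configs = distr M borel \<Theta> \<Otimes>\<^sub>M (distr M borel Y \<Otimes>\<^sub>M distr M borel X)"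
    by (simp only: b X Y T)
  also have "\<dots> = distr M borel (\<lambda>\<omega>. (\<Theta> \<omega>, Y \<omega>, X \<omega>))"
    unfolding YX using TYX by (simp only: borel_prod)
  finally show "distr M borel (\<lambda>\<omega>. (\<Theta> \<omega>, Y \<omega>, X \<omega>)) = configs" by simp
qed

subsection \<open>Summation along the antidiagonal\<close>

lemma tau_ge_3: "l > 0 \<Longrightarrow> tau l \<ge> 3"
  using tau_ge[of l 0 0] by simp

lemma abs_div_le_1:
  fixes u v l :: real
  assumes "l > 0" "u\<^sup>2 + v\<^sup>2 < l\<^sup>2"
  shows "\<bar>u / l\<bar> \<le> 1" "\<bar>v / l\<bar> \<le> 1"
proof -
  have "\<bar>u\<bar>\<^sup>2 \<le> l\<^sup>2" "\<bar>v\<bar>\<^sup>2 \<le> l\<^sup>2"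
    using assms(2) zero_le_power2[of u] zero_le_power2[of v] by (simp_all only: power2_abs)
  then have "\<bar>u\<bar> \<le> l" "\<bar>v\<bar> \<le> l" using assms(1) by (auto intro: power2_le_imp_le simp del: power2_abs)
  then show "\<bar>u / l\<bar> \<le> 1" "\<bar>v / l\<bar> \<le> 1" using assms(1) by auto
qed

lemma less_div_sqrt2_iff:
  fixes k w2 :: real
  assumes "0 \<le> k" "0 \<le> w2"
  shows "k < sqrt w2 / sqrt 2 \<longleftrightarrow> 2 * k\<^sup>2 < w2"
proof -
  have "k < sqrt w2 / sqrt 2 \<longleftrightarrow> sqrt (k\<^sup>2) < sqrt (w2 / 2)"
    using assms by (simp add: real_sqrt_divide)
  also have "\<dots> \<longleftrightarrow> 2 * k\<^sup>2 < w2" by (simp only: real_sqrt_less_iff) auto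
  finally show ?thesis .
qed

text \<open>Among pairs with a given sum \<open>u + v\<close>, the one next to the diagonal has the least
  \<open>u\<^sup>2 + v\<^sup>2\<close>.\<close>

lemma max_pairs_diagonal:
  assumes "l > 0" "int (tau l) = 2 * a + 3 + e" "e \<in> {0, 1}"
  shows "(of_int a)\<^sup>2 + (of_int (a + e))\<^sup>2 < l\<^sup>2"
proof -
  obtain u v :: nat where uv: "(real u)\<^sup>2 + (real v)\<^sup>2 < l\<^sup>2" "tau l \<le> u + v + 3"
    using tau_le[OF assms(1)] by blast
  have t: "int u + int v = 2 * a + e" using tau_ge[OF assms(1) uv(1)] uv(2) assms(2) by linarith
  define d where "d = int u - a"
  have d: "int u = a + d" "int v = a + e - d" using t by (auto simp: d_def)
  \<comment> \<open>The sum of squares exceeds that of the central pair by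
    \<open>2 * d * (d - e)\<close>, and no integer lies strictly between 0 and
    \<open>e\<close>.\<close>
  have "0 \<le> d * (d - e)" using assms(3) by (auto simp: zero_le_mult_iff)
  then have "a\<^sup>2 + (a + e)\<^sup>2 \<le> (int u)\<^sup>2 + (int v)\<^sup>2"
    unfolding d by (simp add: power2_eq_square algebra_simps)
  then have "real_of_int (a\<^sup>2 + (a + e)\<^sup>2) \<le> real_of_int ((int u)\<^sup>2 + (int v)\<^sup>2)" by linarith
  then show ?thesis using uv(1) by simp
qed

text \<open>By maximality of \<open>tau l\<close>, the constraints \<open>i, j \<ge> 2\<close> of \<open>max_pairs\<close> hold automatically.\<close>

lemma max_pairs_image:
  assumes l: "l > 0" and t: "int (tau l) = 2 * a + 3 + e" and e: "e \<in> {0, 1}"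
  shows "max_pairs l = (\<lambda>k. (a - k + 2, a + e + k + 2)) ` {k. (of_int (a - k))\<^sup>2 + (of_int (a + e + k))\<^sup>2 < l\<^sup>2}"
proof (intro set_eqI iffI)
  fix p assume "p \<in> max_pairs l"
  moreover obtain i j where "p = (i, j)" by force
  ultimately have p: "p = (i, j)" "i + j - 1 = int (tau l)" "real_of_int ((i - 2)\<^sup>2 + (j - 2)\<^sup>2) < l\<^sup>2" by auto
  have k: "a - (a + 2 - i) = i - 2" "a + e + (a + 2 - i) = j - 2" using p(2) t by simp_all
  show "p \<in> (\<lambda>k. (a - k + 2, a + e + k + 2)) ` {k. (of_int (a - k))\<^sup>2 + (of_int (a + e + k))\<^sup>2 < l\<^sup>2}"
    by (intro image_eqI[of _ _ "a + 2 - i"]) (use p in \<open>simp_all only: mem_Collect_eq k, simp_all\<close>)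
next
  \<comment> \<open>Replacing a negative \<open>u\<close> by \<open>- u\<close> keeps the sum of
    squares but increases \<open>u + v\<close>, against maximality.\<close>
  have neg: False if uv: "u < 0" "u + v = 2 * a + e" "(real_of_int u)\<^sup>2 + (real_of_int v)\<^sup>2 < l\<^sup>2" for u v :: int
  proof -
    have "a \<ge> 0" using tau_ge_3[OF l] t e by auto
    then have v: "v > 0" using uv e by auto
    have "(real_of_int (- u))\<^sup>2 + (real_of_int v)\<^sup>2 < l\<^sup>2" using uv(3) by simp
    then have "- u + v + 3 \<le> int (tau l)"
      by (intro tau_ge_int l) (use uv v in auto)
    then show False using t uv by simp
  qed
  fix p assume "p \<in> (\<lambda>k. (a - k + 2, a + e + k + 2)) ` {k. (of_int (a - k))\<^sup>2 + (of_int (a + e + k))\<^sup>2 < l\<^sup>2}"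
  then obtain k where k: "p = (a - k + 2, a + e + k + 2)" "(real_of_int (a - k))\<^sup>2 + (real_of_int (a + e + k))\<^sup>2 < l\<^sup>2"
    by blast
  have "a - k \<ge> 0" using neg[of "a - k" "a + e + k"] k(2) by force
  moreover have "a + e + k \<ge> 0" using neg[of "a + e + k" "a - k"] k(2) by (force simp: add.commute)
  moreover have "real_of_int ((a - k + 2 - 2)\<^sup>2 + (a + e + k + 2 - 2)\<^sup>2) < l\<^sup>2" using k(2) by simp
  ultimately show "p \<in> max_pairs l" unfolding k(1) mem_max_pairs using t by auto
qed

text \<open>Both parities at once: \<open>e\<close> is 0 for odd and 1 for even
  \<open>tau l\<close>. The offset \<open>k\<close> runs along the antidiagonal, and
  \<open>k \<mapsto> - e - k\<close> is the reflection in the diagonal, which fixes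
  \<open>k = 0\<close> only if \<open>e = 0\<close>; hence the factor \<open>1 + of_int e\<close>.
  As the length condition is strict, \<open>K\<close> is the largest integer strictly below
  \<open>w / sqrt 2 - of_int e / 2\<close>.\<close>

lemma sum_max_pairs:
  fixes l w :: real and a e :: int
  assumes l: "l > 0" and t: "int (tau l) = 2 * a + 3 + e" and e: "e \<in> {0, 1}"
    and w: "w = sqrt (l\<^sup>2 - (real (tau l) - 3)\<^sup>2 / 2)"
  defines "K \<equiv> \<lceil>w / sqrt 2 - of_int e / 2\<rceil> - 1"
  shows "(\<Sum>(i, j)\<in>max_pairs l. gfun l (of_int (i - 2)) (of_int (j - 2))) =
    (1 + of_int e) * gfun l (of_int a) (of_int (a + e)) +
    2 * (\<Sum>k = 1..K. gfun l (of_int a - of_int k) (of_int (a + e) + of_int k))"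
proof -
  define h where "h k = gfun l (of_int (a - k)) (of_int (a + e + k))" for k
  define w2 where "w2 = l\<^sup>2 - (real (tau l) - 3)\<^sup>2 / 2"
  define S where "S = {k. (real_of_int (a - k))\<^sup>2 + (real_of_int (a + e + k))\<^sup>2 < l\<^sup>2}"
  have rt: "real (tau l) = 2 * of_int a + 3 + of_int e" using t by linarith
  have ee: "(real_of_int e)\<^sup>2 = of_int e" using e by auto
  \<comment> \<open>Completing the square centres the condition at \<open>k = - e / 2\<close>; the
    remaining constant is the one subtracted in \<open>w\<close>.\<close>
  have norm: "(real_of_int (a - k))\<^sup>2 + (real_of_int (a + e + k))\<^sup>2 < l\<^sup>2 \<longleftrightarrow> 2 * (of_int k + of_int e / 2)\<^sup>2 < w2" for k
  proof -
    have "(real_of_int (a - k))\<^sup>2 + (real_of_int (a + e + k))\<^sup>2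
        = 2 * (of_int k + of_int e / 2)\<^sup>2 + (2 * of_int a + of_int e)\<^sup>2 / 2"
      by (simp add: power2_eq_square field_simps)
    then show ?thesis unfolding w2_def rt by (simp add: less_diff_eq)
  qed
  have S_iff: "k \<in> S \<longleftrightarrow> 2 * (of_int k + of_int e / 2)\<^sup>2 < w2" for k
    unfolding S_def using norm by simp
  have "0 \<in> S" using max_pairs_diagonal[OF l t e] by (simp add: S_def)
  then have w2: "0 < w2" unfolding S_iff using zero_le_power2[of "of_int 0 + of_int e / 2 :: real"] by linarith
  have S_pos: "k \<in> S \<longleftrightarrow> k \<le> K" if "k \<ge> 0" for k
  proof -
    have "k \<in> S \<longleftrightarrow> of_int k + of_int e / 2 < w / sqrt 2"
      unfolding S_iff w w2_def[symmetric] by (rule less_div_sqrt2_iff[symmetric]) (use that e w2 in auto)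
    also have "\<dots> \<longleftrightarrow> k \<le> K" by (simp only: K_def zle_diff1_eq less_ceiling_iff less_diff_eq)
    finally show ?thesis .
  qed
  have "K \<ge> 0" using S_pos[of 0] \<open>0 \<in> S\<close> by simp
  have refl: "- e - k \<in> S \<longleftrightarrow> k \<in> S" for k
  proof -
    have "(of_int (- e - k) + of_int e / 2 :: real)\<^sup>2 = (of_int k + of_int e / 2)\<^sup>2"
      by (simp add: power2_eq_square field_simps)
    then show ?thesis unfolding S_iff by simp
  qed
  \<comment> \<open>A negative offset is reflected to a nonnegative one because
    \<open>e \<le> 1\<close>, so \<open>S_pos\<close> describes both halves.\<close>
  have S_eq: "S = {0..K} \<union> (\<lambda>k. - e - k) ` {0..K}"
  proof (intro set_eqI)
    fix k
    have neg: "k \<in> (\<lambda>k. - e - k) ` {0..K} \<longleftrightarrow> - e - k \<in> {0..K}" by force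
    show "k \<in> S \<longleftrightarrow> k \<in> {0..K} \<union> (\<lambda>k. - e - k) ` {0..K}"
      unfolding Un_iff neg using S_pos[of k] S_pos[of "- e - k"] refl[of k] e by (cases "k \<ge> 0") auto
  qed
  have h_refl: "h (- e - k) = h k" if "k \<in> S" for k
  proof -
    have "(real_of_int (a - k))\<^sup>2 + (real_of_int (a + e + k))\<^sup>2 < l\<^sup>2" using that by (simp add: S_def)
    from gfun_sym[OF abs_div_le_1[OF l this]] show ?thesis by (simp add: h_def algebra_simps)
  qed
  have "(\<Sum>(i, j)\<in>max_pairs l. gfun l (of_int (i - 2)) (of_int (j - 2))) = sum h S"
    unfolding max_pairs_image[OF l t e] S_def[symmetric]
    by (subst sum.reindex) (auto simp: inj_on_def h_def)
  also have "\<dots> = (1 + of_int e) * h 0 + 2 * (\<Sum>k = 1..K. h k)"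
  proof -
    have split: "{0..K} = insert 0 {1..K}" using \<open>K \<ge> 0\<close> by auto
    have im: "(\<Sum>k\<in>(\<lambda>k. - e - k) ` A. h k) = (\<Sum>k\<in>A. h k)" if "A \<subseteq> {0..K}" for A
    proof (subst sum.reindex)
      show "(\<Sum>k\<in>A. (h \<circ> (\<lambda>k. - e - k)) k) = (\<Sum>k\<in>A. h k)"
        using that S_pos by (intro sum.cong refl) (auto intro!: h_refl)
    qed (auto simp: inj_on_def)
    from e consider "e = 0" | "e = 1" by auto
    then show ?thesis
    proof cases
      case 1
      \<comment> \<open>The offset 0 is its own mirror image and is left out of the second copy to
        make the union disjoint.\<close>
      have "S = {0..K} \<union> (\<lambda>k. - e - k) ` {1..K}" unfolding S_eq using 1 \<open>K \<ge> 0\<close> by (auto simp: split)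
      then have "sum h S = sum h {0..K} + (\<Sum>k\<in>(\<lambda>k. - e - k) ` {1..K}. h k)"
        using 1 by (simp only:) (rule sum.union_disjoint; auto)
      also have "\<dots> = sum h {0..K} + sum h {1..K}" by (subst im) auto
      finally show ?thesis using 1 by (simp add: split)
    next
      case 2
      have "sum h S = sum h {0..K} + (\<Sum>k\<in>(\<lambda>k. - e - k) ` {0..K}. h k)"
        unfolding S_eq using 2 by (intro sum.union_disjoint) auto
      also have "\<dots> = sum h {0..K} + sum h {0..K}" by (subst im) auto
      finally show ?thesis using 2 by (simp add: split)
    qed
  qed
  finally show ?thesis by (simp add: h_def)
qed

theorem theorem7:
  fixes l w \<rho> :: real and t :: nat
    and M :: "'a measure" and X Y \<Theta> :: "'a \<Rightarrow> real"
  assumes "l > 0"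
    and "t = tau l"
    and "prob_space M"
    and "prob_space.indep_vars M (\<lambda>_. borel) (\<lambda>i. [X, Y, \<Theta>] ! i) {0, 1, 2}"
    and "distr M lborel X = uniform_measure lborel {0..<1}"
    and "distr M lborel Y = uniform_measure lborel {0..<1}"
    and "distr M lborel \<Theta> = uniform_measure lborel {0..<2 * pi}"
    and "\<rho> = measure M {\<omega> \<in> space M. num_visited (segment_at l (X \<omega>) (Y \<omega>) (\<Theta> \<omega>)) = t}"
    and "w = sqrt (l\<^sup>2 - (real t - 3)\<^sup>2 / 2)"
  shows "\<rho> = (\<Sum>(i, j) \<in> {(i :: int, j :: int). i \<ge> 2 \<and> j \<ge> 2 \<and> i + j - 1 = int t \<and>
                               real_of_int ((i - 2)\<^sup>2 + (j - 2)\<^sup>2) < l\<^sup>2}.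
                gfun l (real_of_int (i - 2)) (real_of_int (j - 2)))
       \<and> (odd t \<longrightarrow>
            \<rho> = gfun l ((real t - 3) / 2) ((real t - 3) / 2)
                + 2 * (\<Sum>k = 1..\<lceil>w / sqrt 2 - 1\<rceil>.
                    gfun l ((real t - 3) / 2 - real_of_int k) ((real t - 3) / 2 + real_of_int k)))
       \<and> (even t \<longrightarrow>
            \<rho> = 2 * gfun l ((real t - 4) / 2) ((real t - 2) / 2)
                + 2 * (\<Sum>k = 1..\<lceil>w / sqrt 2 - 3 / 2\<rceil>.
                    gfun l ((real t - 4) / 2 - real_of_int k) ((real t - 2) / 2 + real_of_int k)))"
proof -
  note joint = distr_configs[OF assms(3-7)]
  \<comment> \<open>The event depends on the random variables only through their joint law, which
    \<open>joint\<close> identifies with \<open>configs\<close>.\<close>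
  have "\<rho> = measure (distr M borel (\<lambda>\<omega>. (\<Theta> \<omega>, Y \<omega>, X \<omega>))) {(\<theta>, y, x). num_visited (segment_at l x y \<theta>) = t}"
    unfolding assms(8) by (subst measure_distr[OF joint(1) sets_num_visited]) (rule arg_cong[of _ _ "measure M"]; auto)
  then have rho: "\<rho> = (\<Sum>(i, j)\<in>max_pairs l. gfun l (of_int (i - 2)) (of_int (j - 2)))"
    unfolding joint(2) assms(2) using measure_num_visited_eq_tau[OF assms(1)] by simp
  have w: "w = sqrt (l\<^sup>2 - (real (tau l) - 3)\<^sup>2 / 2)" using assms(2,9) by simp
  have t3: "t \<ge> 3" using tau_ge_3 assms(1,2) by simp
  have "\<rho> = gfun l ((real t - 3) / 2) ((real t - 3) / 2)
                + 2 * (\<Sum>k = 1..\<lceil>w / sqrt 2 - 1\<rceil>.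
                    gfun l ((real t - 3) / 2 - real_of_int k) ((real t - 3) / 2 + real_of_int k))" if "odd t"
  proof -
    obtain b where b: "t = 2 * b + 1" using \<open>odd t\<close> by (elim oddE)
    \<comment> \<open>Here \<open>e = 0\<close>: the central pair lies on the diagonal.\<close>
    have "int (tau l) = 2 * (int b - 1) + 3 + 0" using b assms(2) by simp
    note * = sum_max_pairs[OF assms(1) this _ w, folded rho]
    have "(real t - 3) / 2 = of_int (int b - 1)" using b by simp
    moreover have "\<lceil>w / sqrt 2 - 1\<rceil> = \<lceil>w / sqrt 2 - of_int 0 / 2\<rceil> - 1" by simp
    ultimately show ?thesis using * by (simp only:) simp
  qed
  moreover have "\<rho> = 2 * gfun l ((real t - 4) / 2) ((real t - 2) / 2)
                + 2 * (\<Sum>k = 1..\<lceil>w / sqrt 2 - 3 / 2\<rceil>.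
                    gfun l ((real t - 4) / 2 - real_of_int k) ((real t - 2) / 2 + real_of_int k))" if "even t"
  proof -
    obtain b where b: "t = 2 * b" using \<open>even t\<close> by (elim evenE)
    \<comment> \<open>Here \<open>e = 1\<close>: the central pair is one step off the diagonal and
      occurs with its mirror image.\<close>
    have "int (tau l) = 2 * (int b - 2) + 3 + 1" using b assms(2) by simp
    note * = sum_max_pairs[OF assms(1) this _ w, folded rho]
    have "(real t - 4) / 2 = of_int (int b - 2)" "(real t - 2) / 2 = of_int (int b - 2 + 1)" using b by simp_all
    moreover have "\<lceil>w / sqrt 2 - 3 / 2\<rceil> = \<lceil>w / sqrt 2 - of_int 1 / 2\<rceil> - 1" by linarith
    ultimately show ?thesis using * by (simp only:) simp
  qed
  ultimately show ?thesis using rho unfolding max_pairs_def assms(2) by blast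
qed

end
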